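(* Let $M=(E,\rho)$ be a matroid and $X$ an independent subset of $E$. Let $k=\rho(E)-\rho(X)$ and $n=|E-X|$. Then the contraction $M/X$ is isomorphic to the uniform matroid $U_n^k$ if and only if either $X$ is a basis of $M$, or the following two conditions are satisfied: (1) $X$ is a flat of $M$; (2) for all $Z\in\mathcal{Z}(M)-\{0_{\mathcal{Z}}\}$, we have $\mathrm{cl}(X\cup Z)=E$.
   Context: A matroid $M=(E,\rho)$ is given by its rank function. The closure operator is $\mathrm{cl}(X)=\{e\in E:\rho(X\cup e)=\rho(X)\}$ and the cyclic operator is $\mathrm{cyc}(X)=\{e\in X:\rho(X-e)=\rho(X)\}$. A flat is a set with $\mathrm{cl}(X)=X$; a cyclic flat satisfies additionally $\mathrm{cyc}(X)=X$. $\mathcal{Z}(M)$ is the lattice of cyclic flats under inclusion, and $0_{\mathcal{Z}}=\mathrm{cl}(\emptyset)$ is its bottom element. $M/X$ is the matroid on $E-X$ with rank $A\mapsto\rho(A\cup X)-\rho(X)$. $U_n^k$ is the uniform matroid on $n$ elements with rank function $A\mapsto\min\{|A|,k\}$. *)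

theory Defs
  imports Main
begin

text \<open>
  Only the values of the rank function on subsets of the ground set are meaningful; the axioms
  say nothing about the others, and isomorphism ignores them.
\<close>

record 'a rank_structure =
  ground :: "'a set"
  rank :: "'a set \<Rightarrow> nat"

locale matroid =
  fixes M :: "'a rank_structure"
  assumes finite_ground: "finite (ground M)"
    and rank_le_card: "A \<subseteq> ground M \<Longrightarrow> rank M A \<le> card A"
    and rank_mono: "A \<subseteq> B \<Longrightarrow> B \<subseteq> ground M \<Longrightarrow> rank M A \<le> rank M B"
    and rank_submodular: "A \<subseteq> ground M \<Longrightarrow> B \<subseteq> ground M \<Longrightarrow>
      rank M (A \<union> B) + rank M (A \<inter> B) \<le> rank M A + rank M B"

definition indep :: "'a rank_structure \<Rightarrow> 'a set \<Rightarrow> bool" where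
  "indep M A \<longleftrightarrow> A \<subseteq> ground M \<and> rank M A = card A"

definition basis :: "'a rank_structure \<Rightarrow> 'a set \<Rightarrow> bool" where
  "basis M B \<longleftrightarrow> indep M B \<and> (\<forall>A. indep M A \<longrightarrow> B \<subseteq> A \<longrightarrow> A = B)"

definition cl :: "'a rank_structure \<Rightarrow> 'a set \<Rightarrow> 'a set" where
  "cl M A = {e \<in> ground M. rank M (insert e A) = rank M A}"

definition cyc :: "'a rank_structure \<Rightarrow> 'a set \<Rightarrow> 'a set" where
  "cyc M A = {e \<in> A. rank M (A - {e}) = rank M A}"

definition flat :: "'a rank_structure \<Rightarrow> 'a set \<Rightarrow> bool" where
  "flat M A \<longleftrightarrow> A \<subseteq> ground M \<and> cl M A = A"

definition cyclic_flats :: "'a rank_structure \<Rightarrow> 'a set set" where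
  "cyclic_flats M = {A. flat M A \<and> cyc M A = A}"

text \<open>The bottom of the lattice of cyclic flats; see \<open>zero_Z_least\<close>.\<close>

definition zero_Z :: "'a rank_structure \<Rightarrow> 'a set" where
  "zero_Z M = cl M {}"

text \<open>
  The truncated subtraction is harmless: for \<open>A\<close> and \<open>X\<close> inside the ground set,
  monotonicity gives \<open>rank M X \<le> rank M (A \<union> X)\<close>.
\<close>

definition contraction :: "'a rank_structure \<Rightarrow> 'a set \<Rightarrow> 'a rank_structure" where
  "contraction M X =
    \<lparr>ground = ground M - X, rank = (\<lambda>A. rank M (A \<union> X) - rank M X)\<rparr>"

text \<open>\<open>uniform k n\<close> is $U_n^k$: rank \<open>k\<close> on \<open>n\<close> elements.\<close>

definition uniform :: "nat \<Rightarrow> nat \<Rightarrow> nat rank_structure" where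
  "uniform k n = \<lparr>ground = {..<n}, rank = (\<lambda>A. min (card A) k)\<rparr>"

definition isomorphic :: "'a rank_structure \<Rightarrow> 'b rank_structure \<Rightarrow> bool" where
  "isomorphic M N \<longleftrightarrow> (\<exists>f. bij_betw f (ground M) (ground N) \<and>
    (\<forall>A \<subseteq> ground M. rank N (f ` A) = rank M A))"

lemma matroid_contraction:
  assumes "matroid M" and "X \<subseteq> ground M"
  shows "matroid (contraction M X)"
proof -
  interpret matroid M by fact
  have fX: "finite X" using assms(2) finite_ground finite_subset by blast
  have le: "rank M X \<le> rank M (A \<union> X)" if "A \<subseteq> ground M - X" for A
    using that assms(2) by (intro rank_mono) auto
  show ?thesis
  proof
    fix A assume "A \<subseteq> ground (contraction M X)"
    then have A: "A \<subseteq> ground M" "A \<inter> X = {}" by (auto simp: contraction_def)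
    have "rank M (A \<union> X) + rank M (A \<inter> X) \<le> rank M A + rank M X"
      using A assms(2) by (intro rank_submodular)
    then show "rank (contraction M X) A \<le> card A"
      using rank_le_card[OF A(1)] by (simp add: contraction_def)
  next
    fix A B assume "A \<subseteq> B" "B \<subseteq> ground (contraction M X)"
    then have "rank M (A \<union> X) \<le> rank M (B \<union> X)"
      using assms(2) by (intro rank_mono) (auto simp: contraction_def)
    then show "rank (contraction M X) A \<le> rank (contraction M X) B"
      by (simp add: contraction_def)
  next
    fix A B assume "A \<subseteq> ground (contraction M X)" "B \<subseteq> ground (contraction M X)"
    then have AB: "A \<subseteq> ground M - X" "B \<subseteq> ground M - X" by (auto simp: contraction_def)
    have subm: "rank M ((A \<union> X) \<union> (B \<union> X)) + rank M ((A \<union> X) \<inter> (B \<union> X))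
        \<le> rank M (A \<union> X) + rank M (B \<union> X)"
      using AB assms(2) by (intro rank_submodular) auto
    have eqs: "(A \<union> X) \<union> (B \<union> X) = A \<union> B \<union> X" "(A \<union> X) \<inter> (B \<union> X) = A \<inter> B \<union> X"
      by auto
    have "rank M X \<le> rank M (A \<union> B \<union> X)" "rank M X \<le> rank M (A \<inter> B \<union> X)"
      using AB by (intro le; blast)+
    then show "rank (contraction M X) (A \<union> B) + rank (contraction M X) (A \<inter> B)
        \<le> rank (contraction M X) A + rank (contraction M X) B"
      using subm[unfolded eqs] le[OF AB(1)] le[OF AB(2)]
      unfolding contraction_def rank_structure.simps by linarith
  qed (use finite_ground in \<open>auto simp: contraction_def\<close>)
qed

lemma matroid_uniform: "matroid (uniform k n)"
proof
  fix A B assume "A \<subseteq> ground (uniform k n)" "B \<subseteq> ground (uniform k n)"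
  then have fin: "finite A" "finite B" by (auto simp: uniform_def finite_subset)
  have "card (A \<union> B) + card (A \<inter> B) = card A + card B"
    using card_Un_Int[OF fin] by simp
  moreover have "card (A \<inter> B) \<le> card A" "card (A \<inter> B) \<le> card B"
    using fin by (auto intro: card_mono)
  ultimately show "rank (uniform k n) (A \<union> B) + rank (uniform k n) (A \<inter> B)
      \<le> rank (uniform k n) A + rank (uniform k n) B"
    by (auto simp: uniform_def min_def)
next
  fix A B assume "A \<subseteq> B" "B \<subseteq> ground (uniform k n)"
  then have "card A \<le> card B" by (auto simp: uniform_def intro: card_mono finite_subset)
  then show "rank (uniform k n) A \<le> rank (uniform k n) B" by (auto simp: uniform_def)
qed (auto simp: uniform_def)

lemma (in matroid) zero_Z_least:
  shows "zero_Z M \<in> cyclic_flats M" and "Z \<in> cyclic_flats M \<Longrightarrow> zero_Z M \<subseteq> Z"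
proof -
  have r0: "rank M {} = 0" using rank_le_card[of "{}"] by simp
  have sub: "zero_Z M \<subseteq> ground M" by (auto simp: zero_Z_def cl_def)
  have ins: "rank M (insert e A) = rank M A" if "e \<in> zero_Z M" "A \<subseteq> ground M" for e A
  proof (cases "e \<in> A")
    case False
    have "rank M (A \<union> {e}) + rank M (A \<inter> {e}) \<le> rank M A + rank M {e}"
      using that sub by (intro rank_submodular) auto
    moreover have "rank M {e} = 0" using that(1) r0 by (simp add: zero_Z_def cl_def)
    moreover have "rank M A \<le> rank M (insert e A)"
      using that sub by (intro rank_mono) auto
    ultimately show ?thesis by simp
  qed (simp add: insert_absorb)
  have zero: "rank M A = 0" if "A \<subseteq> zero_Z M" for A
  proof -
    have "finite A" using that sub finite_ground by (meson finite_subset subset_trans)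
    then show ?thesis using that
    proof (induction A)
      case (insert e A)
      moreover have "A \<subseteq> ground M" using insert.prems sub by (meson insert_subset subset_trans)
      ultimately show ?case using ins[of e A] by simp
    qed (simp add: r0)
  qed
  have "e \<in> zero_Z M" if "e \<in> ground M" "rank M (insert e (zero_Z M)) = rank M (zero_Z M)" for e
  proof -
    have "rank M {e} \<le> rank M (insert e (zero_Z M))"
      using that sub by (intro rank_mono) auto
    then show ?thesis using that zero[of "zero_Z M"] r0 by (simp add: zero_Z_def cl_def)
  qed
  then have "cl M (zero_Z M) \<subseteq> zero_Z M" by (auto simp: cl_def)
  moreover have "zero_Z M \<subseteq> cl M (zero_Z M)"
    unfolding cl_def using ins[OF _ sub] sub by blast
  ultimately have "cl M (zero_Z M) = zero_Z M" by (rule subset_antisym)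
  moreover have "cyc M (zero_Z M) = zero_Z M"
    unfolding cyc_def by (simp add: zero[OF Diff_subset] zero[OF subset_refl])
  ultimately show "zero_Z M \<in> cyclic_flats M" using sub by (simp add: cyclic_flats_def flat_def)
  assume "Z \<in> cyclic_flats M"
  then have Z: "Z \<subseteq> ground M" "cl M Z = Z" by (auto simp: cyclic_flats_def flat_def)
  show "zero_Z M \<subseteq> Z"
  proof
    fix e assume e: "e \<in> zero_Z M"
    have "e \<in> cl M Z" unfolding cl_def using ins[OF e Z(1)] e sub by blast
    then show "e \<in> Z" using Z(2) by simp
  qed
qed

end

theory Submission
  imports Defs
begin

text \<open>
  \<open>M/X\<close> is uniform iff \<open>\<rho>(A \<union> X) - \<rho>(X)\<close> is the minimum of \<open>|A|\<close> and \<open>k\<close> for every \<open>A\<close>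
  disjoint from \<open>X\<close>, i.e. iff every dependent superset of \<open>X\<close> spans \<open>M\<close>. If \<open>X\<close> is an
  independent flat, then \<open>M\<close> has no loops, so the nonzero cyclic flats are the nonempty ones.
  These are dependent, and conversely every dependent set contains a circuit, whose closure is
  a nonempty cyclic flat.
\<close>

section \<open>Isomorphism with a uniform matroid\<close>

text \<open>Rank in \<open>uniform k n\<close> depends only on cardinality, which every bijection
  preserves. Hence any bijection of the ground sets serves, and only a count and a rank formula
  remain.\<close>

lemma isomorphic_uniform_iff:
  assumes fin: "finite (ground N)"
  shows "isomorphic N (uniform k n) \<longleftrightarrow>
    card (ground N) = n \<and> (\<forall>A \<subseteq> ground N. rank N A = min (card A) k)"
proof -
  have card_image_bij: "card (f ` A) = card A"
    if "bij_betw f (ground N) {..<n}" "A \<subseteq> ground N" for f A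
    using that by (meson bij_betw_def card_image inj_on_subset)
  have "(\<exists>f. bij_betw f (ground N) {..<n}) \<longleftrightarrow> card (ground N) = n"
    using bij_betw_same_card[of _ "ground N" "{..<n}"]
      finite_same_card_bij[OF fin finite_lessThan[of n]] by auto
  then show ?thesis
    unfolding isomorphic_def uniform_def rank_structure.simps
    by (auto simp: card_image_bij)
qed

context matroid
begin

section \<open>Subadditivity of rank and independent sets\<close>

lemma finite_subset_ground: "A \<subseteq> ground M \<Longrightarrow> finite A"
  using finite_ground finite_subset by blast

lemma rank_union_le:
  "A \<subseteq> ground M \<Longrightarrow> B \<subseteq> ground M \<Longrightarrow> rank M (A \<union> B) \<le> rank M A + rank M B"
  using rank_submodular[of A B] by linarith

text \<open>By subadditivity, adding \<open>B - A\<close> raises the rank by at most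
  \<open>card (B - A)\<close>, so a rank deficit in \<open>A\<close> would persist in
  \<open>B\<close>.\<close>

lemma indep_subset:
  assumes B: "indep M B" and AB: "A \<subseteq> B"
  shows "indep M A"
proof -
  have sub: "A \<subseteq> ground M" "B - A \<subseteq> ground M" and finB: "finite B"
    using assms finite_subset_ground by (auto simp: indep_def)
  have "card A + card (B - A) = card B"
    using finB AB by (metis card_Diff_subset card_mono finite_subset le_add_diff_inverse)
  also have "\<dots> = rank M (A \<union> (B - A))"
    using B AB by (simp add: indep_def Un_absorb1)
  also have "\<dots> \<le> rank M A + card (B - A)"
    using rank_union_le[OF sub] rank_le_card[OF sub(2)] by linarith
  finally show ?thesis
    using rank_le_card[OF sub(1)] sub(1) by (simp add: indep_def)
qed

section \<open>Closure and flats\<close>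

lemma cl_subset_ground: "cl M A \<subseteq> ground M"
  by (auto simp: cl_def)

lemma subset_cl: "A \<subseteq> ground M \<Longrightarrow> A \<subseteq> cl M A"
  by (auto simp: cl_def insert_absorb)

text \<open>Elements of the closure are added one at a time; by submodularity each still adds no
  rank to the enlarged set.\<close>

lemma rank_union_eq_if_subset_cl:
  assumes A: "A \<subseteq> ground M" and B: "B \<subseteq> cl M A"
  shows "rank M (A \<union> B) = rank M A"
proof -
  have "finite B"
    using B cl_subset_ground finite_subset_ground by blast
  then show ?thesis using B
  proof (induction B)
    case (insert e B)
    have sub: "A \<union> B \<subseteq> ground M" "insert e A \<subseteq> ground M"
      using A insert.prems cl_subset_ground by blast+
    have eqs: "(A \<union> B) \<union> insert e A = A \<union> insert e B"
      by auto
    have "rank M (A \<union> insert e B) + rank M ((A \<union> B) \<inter> insert e A)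
        \<le> rank M (A \<union> B) + rank M (insert e A)"
      using rank_submodular[OF sub] by (simp only: eqs)
    moreover have "rank M A \<le> rank M ((A \<union> B) \<inter> insert e A)"
      using sub by (intro rank_mono) auto
    moreover have "rank M (insert e A) = rank M A"
      using insert.prems by (simp add: cl_def)
    moreover have "rank M (A \<union> B) = rank M A"
      using insert by simp
    moreover have "rank M A \<le> rank M (A \<union> insert e B)"
      using sub by (intro rank_mono) auto
    ultimately show ?case by linarith
  qed simp
qed

lemma rank_cl: "A \<subseteq> ground M \<Longrightarrow> rank M (cl M A) = rank M A"
  using rank_union_eq_if_subset_cl[of A "cl M A"] subset_cl by (simp add: Un_absorb1)

text \<open>Submodularity gives diminishing returns: \<open>e\<close> adds no more rank to
  \<open>B\<close> than to \<open>A\<close>.\<close>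

lemma cl_mono:
  assumes AB: "A \<subseteq> B" and B: "B \<subseteq> ground M"
  shows "cl M A \<subseteq> cl M B"
proof
  fix e assume e: "e \<in> cl M A"
  then have eg: "e \<in> ground M" and re: "rank M (insert e A) = rank M A"
    by (auto simp: cl_def)
  have "rank M (B \<union> insert e A) + rank M (B \<inter> insert e A) \<le> rank M B + rank M (insert e A)"
    using AB B eg by (intro rank_submodular) auto
  moreover have "B \<union> insert e A = insert e B"
    using AB by auto
  moreover have "rank M A \<le> rank M (B \<inter> insert e A)" "rank M B \<le> rank M (insert e B)"
    using AB B eg by (auto intro: rank_mono)
  ultimately show "e \<in> cl M B"
    using re eg by (simp add: cl_def)
qed

text \<open>The content is idempotence: \<open>cl M A\<close> has the rank of \<open>A\<close>, so
  an element that adds no rank to it adds none to \<open>A\<close>.\<close>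

lemma flat_cl:
  assumes A: "A \<subseteq> ground M"
  shows "flat M (cl M A)"
proof -
  have "e \<in> cl M A" if e: "e \<in> cl M (cl M A)" for e
  proof -
    have eg: "e \<in> ground M" and re: "rank M (insert e (cl M A)) = rank M A"
      using e rank_cl[OF A] by (auto simp: cl_def)
    have "rank M (insert e A) \<le> rank M (insert e (cl M A))"
      using subset_cl[OF A] cl_subset_ground eg by (intro rank_mono) auto
    moreover have "rank M A \<le> rank M (insert e A)"
      using A eg by (intro rank_mono) auto
    ultimately show ?thesis
      using re eg by (simp add: cl_def)
  qed
  then show ?thesis
    using subset_cl[OF cl_subset_ground] cl_subset_ground by (auto simp: flat_def)
qed

section \<open>Cyclic sets and cyclic flats\<close>

text \<open>Deleting an element of \<open>A\<close> keeps the rank of \<open>A\<close> by cyclicity,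
  and deleting any other keeps \<open>A\<close> itself; either way the rest still has the rank of
  the closure.\<close>

lemma cl_cyclic_flat:
  assumes A: "A \<subseteq> ground M" and cyc: "cyc M A = A"
  shows "cl M A \<in> cyclic_flats M"
proof -
  have "rank M (cl M A - {e}) = rank M (cl M A)" for e
  proof -
    have "rank M (A - {e}) = rank M A"
      using cyc by (cases "e \<in> A") (auto simp: cyc_def)
    moreover have "rank M (A - {e}) \<le> rank M (cl M A - {e})"
      using subset_cl[OF A] cl_subset_ground by (intro rank_mono) auto
    moreover have "rank M (cl M A - {e}) \<le> rank M (cl M A)"
      using cl_subset_ground by (intro rank_mono) auto
    ultimately show ?thesis
      using rank_cl[OF A] by linarith
  qed
  then show ?thesis
    using flat_cl[OF A] by (simp add: cyclic_flats_def cyc_def)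
qed

text \<open>Deleting an element of an independent set lowers its cardinality, hence its rank. In
  particular, a set that is both cyclic and independent is empty.\<close>

lemma indep_cyc_empty:
  assumes "indep M A"
  shows "cyc M A = {}"
proof -
  have "rank M (A - {e}) \<noteq> rank M A" if "e \<in> A" for e
  proof -
    have "finite A"
      using assms finite_subset_ground by (simp add: indep_def)
    then have "card (A - {e}) < card A"
      using that by (meson card_Diff1_less)
    moreover have "indep M (A - {e})"
      using assms indep_subset by blast
    ultimately show ?thesis
      using assms by (simp add: indep_def)
  qed
  then show ?thesis by (auto simp: cyc_def)
qed

text \<open>A minimal dependent subset, i.e. a circuit, is cyclic.\<close>

lemma dependent_contains_cyclic:
  assumes A: "A \<subseteq> ground M" and dep: "\<not> indep M A"
  obtains C where "C \<subseteq> A" "C \<noteq> {}" "cyc M C = C"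
proof -
  define P where "P D \<longleftrightarrow> D \<subseteq> A \<and> \<not> indep M D" for D
  have "P A" using dep by (simp add: P_def)
  then obtain C where "P C" and min: "\<And>D. P D \<Longrightarrow> card C \<le> card D"
    using ex_has_least_nat[of P A card] by blast
  then have C: "C \<subseteq> A" "\<not> indep M C" by (simp_all add: P_def)
  have Cg: "C \<subseteq> ground M" and finC: "finite C"
    using A C finite_subset_ground by auto
  have lt: "rank M C < card C"
    using rank_le_card[OF Cg] C(2) Cg by (simp add: indep_def)
  have "rank M (C - {e}) = rank M C" if e: "e \<in> C" for e
  proof -
    have "card (C - {e}) < card C"
      using e finC by (meson card_Diff1_less)
    \<comment> \<open>Minimality of \<open>card C\<close> makes \<open>C - {e}\<close> independent,
      of rank \<open>card C - 1\<close>; the rank of the dependent set \<open>C\<close> cannot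
      exceed this.\<close>
    then have "indep M (C - {e})"
      using min[of "C - {e}"] C(1) by (auto simp: P_def)
    then have "rank M (C - {e}) = card C - 1"
      using e finC by (simp add: indep_def)
    moreover have "rank M (C - {e}) \<le> rank M C"
      using Cg by (intro rank_mono) auto
    ultimately show ?thesis using lt by linarith
  qed
  then have "cyc M C = C" by (auto simp: cyc_def)
  moreover have "C \<noteq> {}" using lt by auto
  ultimately show ?thesis using that C(1) by blast
qed

section \<open>Bases as independent sets of full rank\<close>

lemma basis_iff_rank:
  assumes X: "indep M X"
  shows "basis M X \<longleftrightarrow> rank M X = rank M (ground M)"
proof
  assume "basis M X"
  then have max: "\<And>A. indep M A \<Longrightarrow> X \<subseteq> A \<Longrightarrow> A = X"
    by (auto simp: basis_def)
  have Xg: "X \<subseteq> ground M" and finX: "finite X"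
    using X finite_subset_ground by (auto simp: indep_def)
  have "e \<in> cl M X" if e: "e \<in> ground M" for e
  proof (cases "e \<in> X")
    case True
    then show ?thesis using subset_cl[OF Xg] by blast
  next
    case False
    then have "\<not> indep M (insert e X)" using max by blast
    moreover have "rank M (insert e X) \<le> card (insert e X)" "rank M X \<le> rank M (insert e X)"
      using Xg e by (auto intro!: rank_le_card rank_mono)
    moreover have "rank M X = card X" using X by (simp add: indep_def)
    \<comment> \<open>The rank is \<open>card X\<close> or \<open>card X + 1\<close>, and dependence
      rules out the latter.\<close>
    ultimately have "rank M (insert e X) = rank M X"
      using False finX Xg e by (simp add: indep_def)
    then show ?thesis using e by (simp add: cl_def)
  qed
  then have "cl M X = ground M" using cl_subset_ground by blast
  then show "rank M X = rank M (ground M)" using rank_cl[OF Xg] by simp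
next
  assume eq: "rank M X = rank M (ground M)"
  have "A = X" if A: "indep M A" "X \<subseteq> A" for A
  proof -
    have "card A \<le> card X"
      using A X eq rank_mono[of A "ground M"] by (simp add: indep_def)
    moreover have "finite A" using A finite_subset_ground by (simp add: indep_def)
    ultimately show ?thesis using A(2) card_seteq by metis
  qed
  then show "basis M X" using X by (simp add: basis_def)
qed

end

section \<open>Uniform contractions by independent sets\<close>

theorem theorem4p5:
  fixes M :: "'a rank_structure" and X :: "'a set" and k n :: nat
  assumes "matroid M"
    and "indep M X"
    and "k = rank M (ground M) - rank M X"
    and "n = card (ground M - X)"
  shows "isomorphic (contraction M X) (uniform k n) \<longleftrightarrow>
    basis M X \<or>
    (flat M X \<and> (\<forall>Z \<in> cyclic_flats M - {zero_Z M}. cl M (X \<union> Z) = ground M))"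
proof -
  interpret matroid M by fact
  have X: "X \<subseteq> ground M" "rank M X = card X" and finX: "finite X"
    using assms(2) finite_subset_ground by (auto simp: indep_def)
  have rX: "rank M X \<le> rank M (X \<union> A)" "rank M (X \<union> A) \<le> rank M (ground M)"
    if "A \<subseteq> ground M" for A
    using that X(1) by (auto intro: rank_mono)
  have iso_iff: "isomorphic (contraction M X) (uniform k n) \<longleftrightarrow>
      (\<forall>A \<subseteq> ground M - X. rank M (X \<union> A) - rank M X = min (card A) k)"
    using isomorphic_uniform_iff[of "contraction M X" k n] finite_ground assms(4)
    by (simp add: contraction_def Un_commute)
  \<comment> \<open>With \<open>rank M X\<close> in place of \<open>card X\<close>, independence of
    \<open>X \<union> A\<close> says that \<open>A\<close> adds rank exactly \<open>card A\<close>
    to \<open>X\<close>.\<close>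
  have card_Un: "card (X \<union> A) = rank M X + card A" if "A \<subseteq> ground M - X" for A
    using that X(2) finX finite_subset_ground[of A] by (subst card_Un_disjoint) auto
  \<comment> \<open>\<open>zero_Z M\<close> is cyclic, and independent as a subset of the flat
    \<open>X\<close>, hence empty.\<close>
  have zero_empty: "zero_Z M = {}" if "flat M X"
  proof -
    have "zero_Z M \<subseteq> X"
      using cl_mono[of "{}" X] X(1) that by (simp add: zero_Z_def flat_def)
    then have "indep M (zero_Z M)" using assms(2) indep_subset by blast
    moreover have "cyc M (zero_Z M) = zero_Z M"
      using zero_Z_least(1) by (simp add: cyclic_flats_def)
    ultimately show ?thesis using indep_cyc_empty by simp
  qed
  show ?thesis unfolding iso_iff
  proof (intro iffI)
    assume unif: "\<forall>A \<subseteq> ground M - X. rank M (X \<union> A) - rank M X = min (card A) k"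
    have "flat M X \<and> (\<forall>Z \<in> cyclic_flats M - {zero_Z M}. cl M (X \<union> Z) = ground M)"
      if nb: "\<not> basis M X"
    proof
      \<comment> \<open>With \<open>k\<close> positive, the uniform formula gives every single
        element outside \<open>X\<close> a rank gain of 1.\<close>
      have "k > 0"
        using nb basis_iff_rank[OF assms(2)] rX(2)[of "{}"] assms(3) by simp
      then have "rank M (insert e X) \<noteq> rank M X" if "e \<in> ground M - X" for e
        using unif[rule_format, of "{e}"] that by auto
      then have "cl M X \<subseteq> X" by (auto simp: cl_def)
      then show fl: "flat M X" using subset_cl X(1) by (auto simp: flat_def)
      show "\<forall>Z \<in> cyclic_flats M - {zero_Z M}. cl M (X \<union> Z) = ground M"
      proof
        fix Z assume "Z \<in> cyclic_flats M - {zero_Z M}"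
        then have Z: "Z \<subseteq> ground M" "cyc M Z = Z" "Z \<noteq> {}"
          using zero_empty[OF fl] by (auto simp: cyclic_flats_def flat_def)
        \<comment> \<open>Dependence of \<open>Z\<close> passes to \<open>X \<union> Z\<close>, so
          \<open>Z - X\<close> adds less rank than its cardinality. The minimum is then
          \<open>k\<close>, which means full rank.\<close>
        then have "\<not> indep M Z" using indep_cyc_empty by auto
        then have "\<not> indep M (X \<union> Z)" using indep_subset by blast
        moreover have "card (X \<union> Z) = rank M X + card (Z - X)"
          using card_Un[of "Z - X"] Z(1) by (simp add: Diff_mono)
        ultimately have "rank M (X \<union> Z) \<noteq> rank M X + card (Z - X)"
          using X(1) Z(1) by (simp add: indep_def)
        moreover have "rank M (X \<union> Z) - rank M X = min (card (Z - X)) k"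
          using unif[rule_format, of "Z - X"] Z(1) by (simp add: Diff_mono)
        ultimately have "rank M (X \<union> Z) = rank M (ground M)"
          using rX[OF Z(1)] assms(3) by (auto simp: min_def split: if_splits)
        moreover have "rank M (X \<union> Z) \<le> rank M (insert e (X \<union> Z))"
          "rank M (insert e (X \<union> Z)) \<le> rank M (ground M)" if "e \<in> ground M" for e
          using that X(1) Z(1) by (auto intro: rank_mono)
        ultimately have "rank M (insert e (X \<union> Z)) = rank M (X \<union> Z)" if "e \<in> ground M" for e
          using that by (metis le_antisym)
        then show "cl M (X \<union> Z) = ground M" by (auto simp: cl_def)
      qed
    qed
    then show "basis M X \<or>
      (flat M X \<and> (\<forall>Z \<in> cyclic_flats M - {zero_Z M}. cl M (X \<union> Z) = ground M))"
      by blast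
  next
    assume rhs: "basis M X \<or>
      (flat M X \<and> (\<forall>Z \<in> cyclic_flats M - {zero_Z M}. cl M (X \<union> Z) = ground M))"
    have spanning: "rank M (X \<union> A) = rank M (ground M)"
      if A: "A \<subseteq> ground M" and dep: "\<not> indep M (X \<union> A)" for A
      using rhs
    proof
      assume "basis M X"
      then show ?thesis using basis_iff_rank[OF assms(2)] rX[OF A] by simp
    next
      assume *: "flat M X \<and> (\<forall>Z \<in> cyclic_flats M - {zero_Z M}. cl M (X \<union> Z) = ground M)"
      have XA: "X \<union> A \<subseteq> ground M" using X(1) A by simp
      obtain C where C: "C \<subseteq> X \<union> A" "C \<noteq> {}" "cyc M C = C"
        using dependent_contains_cyclic[OF XA dep] .
      have Cg: "C \<subseteq> ground M" using C(1) XA by blast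
      \<comment> \<open>\<open>C\<close> is nonempty and \<open>zero_Z M\<close> is empty, so the
        hypothesis applies to the closure of \<open>C\<close>.\<close>
      have "cl M C \<in> cyclic_flats M - {zero_Z M}"
        using cl_cyclic_flat[OF Cg C(3)] subset_cl[OF Cg] C(2) zero_empty * by auto
      then have "cl M (X \<union> cl M C) = ground M" using * by blast
      \<comment> \<open>Both \<open>X\<close> and \<open>cl M C\<close> lie in
        \<open>cl M (X \<union> A)\<close>, so idempotence carries spanning over to
        \<open>X \<union> A\<close>.\<close>
      moreover have "cl M (X \<union> cl M C) \<subseteq> cl M (cl M (X \<union> A))"
        using subset_cl[OF XA] cl_mono[OF C(1) XA] cl_subset_ground by (intro cl_mono) auto
      moreover have "cl M (cl M (X \<union> A)) = cl M (X \<union> A)"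
        using flat_cl[OF XA] by (simp add: flat_def)
      ultimately have "cl M (X \<union> A) = ground M" using cl_subset_ground by blast
      then show ?thesis using rank_cl[OF XA] by simp
    qed
    show "\<forall>A \<subseteq> ground M - X. rank M (X \<union> A) - rank M X = min (card A) k"
    proof (intro allI impI)
      fix A assume A: "A \<subseteq> ground M - X"
      then have Ag: "A \<subseteq> ground M" by blast
      have le: "rank M (X \<union> A) \<le> rank M X + card A"
        using rank_le_card[of "X \<union> A"] card_Un[OF A] X(1) Ag by simp
      show "rank M (X \<union> A) - rank M X = min (card A) k"
      proof (cases "indep M (X \<union> A)")
        \<comment> \<open>The rank gain is \<open>card A\<close>, which is at most \<open>k\<close>
          because the rank of the ground set bounds it.\<close>
        case True
        then show ?thesis
          using card_Un[OF A] rX[OF Ag] assms(3) by (simp add: indep_def)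
      next
        \<comment> \<open>Spanning makes the gain exactly \<open>k\<close>, and \<open>le\<close>
          then gives \<open>k \<le> card A\<close>.\<close>
        case False
        then show ?thesis
          using spanning[OF Ag] le assms(3) by simp
      qed
    qed
  qed
qed

end
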